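(* Let $A \subseteq \{1,3,5,\ldots\}$ and $B \subseteq \{2,4,6,\ldots\}$ be such that $1 \in A$ and $A \cup B$ is odd-ended. Define $(c_n)_{n \ge 0}$ by $$\left(1-\sum_{a \in A} \frac{x^a}{a!} + \sum_{b \in B} \frac{x^b}{b!}\right)^{-1} = \sum_{n \ge 0} c_n \frac{x^n}{n!}.$$ Then every $c_n$ is a non-negative integer, and moreover, for every $n\ge 0$, $c_n$ is the number of $A,B$-good ordered set partitions of $[n]=\{1,\ldots,n\}$.
   Context: The sets $A,B$ may be finite or infinite. Write $A\cup B$ as the disjoint union of its maximal intervals of consecutive integers (an interval may be infinite, of the form $[c,\infty)$). $A \cup B$ is odd-ended if all (finite) endpoints of these maximal intervals are odd. The maximum of a maximal interval (if it exists) is called a top element; the minimum of a maximal interval is called a bottom element. A number may be both. An ordered set partition of $[n]$ is a sequence $P=P_1/P_2/\cdots/P_\ell$ of pairwise disjoint nonempty sets (blocks) with union $[n]$ (for $n=0$, there is exactly one, the empty one). A singleton is a block of size 1. Freeze skip pairs of $P$ are determined by scanning $P$ from right to left, starting with $j=\ell$: when block $P_j$ is considered, if $j\ge 2$, $P_j=\{k\}$ is a singleton, $k>\max P_{j-1}$ and $|P_{j-1}|+1\notin A\cup B$, then $(P_{j-1},P_j)$ is a freeze skip pair and the scan continues with $P_{j-2}$; otherwise the scan continues with $P_{j-1}$. $P$ is $A,B$-good if: (1) every block size is either $1$ or an endpoint (top or bottom element) of a maximal interval of $A\cup B$; (2) every block whose size is a top element that is not a bottom element belongs to a freeze skip pair;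 (3) no block $P_i$ whose size is a bottom element that is not a top element is immediately followed by a singleton $P_{i+1}=\{k\}$ with $k>\max P_i$ that is not in a freeze skip pair. *)

theory Defs
  imports "HOL-Computational_Algebra.Formal_Power_Series"
begin

definition consecutive :: "nat set \<Rightarrow> bool" where
  "consecutive I \<longleftrightarrow> I \<noteq> {} \<and> (\<forall>x\<in>I. \<forall>z\<in>I. \<forall>y. x \<le> y \<and> y \<le> z \<longrightarrow> y \<in> I)"

definition maximal_interval :: "nat set \<Rightarrow> nat set \<Rightarrow> bool" where
  "maximal_interval S I \<longleftrightarrow> I \<subseteq> S \<and> consecutive I \<and>
     (\<forall>J. consecutive J \<and> I \<subseteq> J \<and> J \<subseteq> S \<longrightarrow> J = I)"

definition top_element :: "nat set \<Rightarrow> nat \<Rightarrow> bool" where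
  "top_element S t \<longleftrightarrow> (\<exists>I. maximal_interval S I \<and> t \<in> I \<and> (\<forall>x\<in>I. x \<le> t))"

definition bottom_element :: "nat set \<Rightarrow> nat \<Rightarrow> bool" where
  "bottom_element S b \<longleftrightarrow> (\<exists>I. maximal_interval S I \<and> b \<in> I \<and> (\<forall>x\<in>I. b \<le> x))"

definition odd_ended :: "nat set \<Rightarrow> bool" where
  "odd_ended S \<longleftrightarrow> (\<forall>e. top_element S e \<or> bottom_element S e \<longrightarrow> odd e)"

definition ordered_set_partition :: "nat \<Rightarrow> nat set list \<Rightarrow> bool" where
  "ordered_set_partition n P \<longleftrightarrow>
     (\<forall>i<length P. P ! i \<noteq> {}) \<and>
     (\<forall>i<length P. \<forall>j<length P. i \<noteq> j \<longrightarrow> P ! i \<inter> P ! j = {}) \<and>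
     \<Union> (set P) = {1..n}"

text \<open>
  Blocks are indexed from 0, so the block written \<open>P\<^sub>j\<close> on paper is \<open>P ! (j - 1)\<close>.
  The last argument of \<open>freeze_scan\<close> is the number \<open>j\<close> of blocks not yet
  scanned, so that the block under consideration is the \<open>j\<close>-th one; a pair of blocks
  is recorded as the pair of their indices.
\<close>

fun freeze_scan :: "nat set \<Rightarrow> nat set list \<Rightarrow> nat \<Rightarrow> (nat \<times> nat) set" where
  "freeze_scan S P 0 = {}"
| "freeze_scan S P (Suc 0) = {}"
| "freeze_scan S P (Suc (Suc j)) =
     (if (\<exists>k. P ! Suc j = {k} \<and> k > Max (P ! j)) \<and> card (P ! j) + 1 \<notin> S
      then insert (j, Suc j) (freeze_scan S P j)
      else freeze_scan S P (Suc j))"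

definition freeze_skip_pairs :: "nat set \<Rightarrow> nat set \<Rightarrow> nat set list \<Rightarrow> (nat \<times> nat) set" where
  "freeze_skip_pairs A B P = freeze_scan (A \<union> B) P (length P)"

definition in_freeze_skip_pair :: "nat set \<Rightarrow> nat set \<Rightarrow> nat set list \<Rightarrow> nat \<Rightarrow> bool" where
  "in_freeze_skip_pair A B P i \<longleftrightarrow> (\<exists>(p, q) \<in> freeze_skip_pairs A B P. i = p \<or> i = q)"

definition good :: "nat set \<Rightarrow> nat set \<Rightarrow> nat set list \<Rightarrow> bool" where
  "good A B P \<longleftrightarrow>
     (\<forall>i<length P. card (P ! i) = 1 \<or> top_element (A \<union> B) (card (P ! i)) \<or>
        bottom_element (A \<union> B) (card (P ! i))) \<and>
     (\<forall>i<length P. top_element (A \<union> B) (card (P ! i)) \<and>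
        \<not> bottom_element (A \<union> B) (card (P ! i)) \<longrightarrow> in_freeze_skip_pair A B P i) \<and>
     \<not> (\<exists>i k. Suc i < length P \<and> bottom_element (A \<union> B) (card (P ! i)) \<and>
        \<not> top_element (A \<union> B) (card (P ! i)) \<and> P ! Suc i = {k} \<and> k > Max (P ! i) \<and>
        \<not> in_freeze_skip_pair A B P (Suc i))"

definition set_egf :: "nat set \<Rightarrow> real fps" where
  "set_egf S = Abs_fps (\<lambda>n. if n \<in> S then 1 / fact n else 0)"

lemma finite_ordered_set_partitions: "finite {P. ordered_set_partition n P}"
proof (rule finite_subset)
  show "{P. ordered_set_partition n P} \<subseteq> {P. set P \<subseteq> Pow {1..n} \<and> distinct P}"
    by (auto simp: ordered_set_partition_def distinct_conv_nth) (metis Int_absorb)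
next
  show "finite {P. set P \<subseteq> Pow {1..n} \<and> distinct P}"
    by (rule finite_subset_distinct) simp
qed

end

theory Submission
  imports Defs
begin

text \<open>Write \<open>F\<close> for the power series to be inverted and \<open>S = A \<union> B\<close>. Pascal's rule shows that
  the coefficients of \<open>e\<^sup>x F - 1\<close> as an exponential generating function are \<open>- w\<^sub>k\<close>, where \<open>w\<^sub>k\<close> is
  the sum of \<open>k - 1\<close> choose \<open>t\<close> over the tops \<open>t\<close> of \<open>S\<close> and of \<open>k - 1\<close> choose \<open>s - 1\<close> over the bottoms \<open>s > 1\<close>. Hence
  \<open>c\<^sub>n = 1 + (\<Sum>k = 1..n. (n choose k) * w\<^sub>k * c\<^bsub>n - k\<^esub>)\<close>.

  Good partitions satisfy the same recursion. Either all blocks are singletons in decreasing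
  order, or the partition ends uniquely in an \<^emph>\<open>item\<close>: a block \<open>Q\<close> followed by singletons in
  decreasing order, where, with \<open>K\<close> the set of all elements involved, either \<open>|Q|\<close> is a top and
  \<open>Max K \<notin> Q\<close> (so that \<open>Q\<close> and \<open>{Max K}\<close> form a freeze skip pair), or \<open>|Q| > 1\<close> is a bottom and
  \<open>Max K \<in> Q\<close>. There are \<open>w\<^sub>k\<close> items on a set of size \<open>k\<close>, and removing an item affects neither
  goodness nor the freeze skip pairs of the remaining blocks.\<close>

section \<open>Endpoints of maximal intervals as membership conditions\<close>

lemma consecutiveD: "consecutive I \<Longrightarrow> x \<in> I \<Longrightarrow> z \<in> I \<Longrightarrow> x \<le> y \<Longrightarrow> y \<le> z \<Longrightarrow> y \<in> I"
  unfolding consecutive_def by blast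

text \<open>If \<open>Suc t\<close> lay in \<open>S\<close>, it would extend a maximal interval with
  maximum \<open>t\<close>. Conversely, the numbers from which \<open>S\<close> runs unbroken up to
  \<open>t\<close> form a maximal interval.\<close>

lemma top_element_iff: "top_element S t \<longleftrightarrow> t \<in> S \<and> Suc t \<notin> S"
proof
  assume "top_element S t"
  then obtain I where I: "maximal_interval S I" "t \<in> I" "\<forall>x\<in>I. x \<le> t"
    by (auto simp: top_element_def)
  have "insert (Suc t) I = I" if "Suc t \<in> S"
  proof -
    have "consecutive (insert (Suc t) I)"
      unfolding consecutive_def
    proof (intro conjI ballI allI impI)
      fix x y z assume xz: "x \<in> insert (Suc t) I" "z \<in> insert (Suc t) I" "x \<le> y \<and> y \<le> z"
      have "z \<le> Suc t" using xz(2) I(3) by auto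
      show "y \<in> insert (Suc t) I"
      proof (cases "y = Suc t")
        case False
        then have "y \<le> t" using \<open>z \<le> Suc t\<close> xz(3) by simp
        moreover from this have "x \<in> I" using xz(1,3) by auto
        ultimately show ?thesis
          using I xz(3) unfolding maximal_interval_def consecutive_def by blast
      qed simp
    qed simp
    then show ?thesis
      using I that unfolding maximal_interval_def by blast
  qed
  then show "t \<in> S \<and> Suc t \<notin> S"
    using I unfolding maximal_interval_def by (metis Suc_n_not_le_n insertI1 subsetD)
next
  assume t: "t \<in> S \<and> Suc t \<notin> S"
  define I where "I = {x. x \<le> t \<and> {x..t} \<subseteq> S}"
  have "consecutive I" "t \<in> I" "I \<subseteq> S"
    using t by (auto simp: consecutive_def I_def)
  moreover have "J \<subseteq> I" if J: "consecutive J" "I \<subseteq> J" "J \<subseteq> S" for J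
  proof
    fix x assume x: "x \<in> J"
    have tJ: "t \<in> J" using J \<open>t \<in> I\<close> by auto
    have "x \<le> t"
    proof (rule ccontr)
      assume "\<not> x \<le> t"
      then have "t \<le> Suc t" "Suc t \<le> x" by auto
      then have "Suc t \<in> J" using J(1) x tJ unfolding consecutive_def by blast
      then show False using t J by auto
    qed
    moreover have "{x..t} \<subseteq> J" using consecutiveD[OF J(1) x tJ] by auto
    ultimately show "x \<in> I" using J by (auto simp: I_def)
  qed
  ultimately have "maximal_interval S I" unfolding maximal_interval_def by blast
  then show "top_element S t"
    using \<open>t \<in> I\<close> unfolding top_element_def I_def by blast
qed

text \<open>Mirror image of the argument for tops. Quantifying over \<open>b = Suc a\<close> makes
  the condition vacuous at \<open>b = 0\<close>, where the truncated \<open>b - 1\<close> would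
  return \<open>b\<close> itself.\<close>

lemma bottom_element_iff:
  "bottom_element S b \<longleftrightarrow> b \<in> S \<and> (\<forall>a. b = Suc a \<longrightarrow> a \<notin> S)"
proof
  assume "bottom_element S b"
  then obtain I where I: "maximal_interval S I" "b \<in> I" "\<forall>x\<in>I. b \<le> x"
    by (auto simp: bottom_element_def)
  have "insert a I = I" if "b = Suc a" "a \<in> S" for a
  proof -
    have "consecutive (insert a I)"
      unfolding consecutive_def
    proof (intro conjI ballI allI impI)
      fix x y z assume xz: "x \<in> insert a I" "z \<in> insert a I" "x \<le> y \<and> y \<le> z"
      have "a \<le> x" using xz(1) I(3) that(1) by auto
      show "y \<in> insert a I"
      proof (cases "y = a")
        case False
        then have "b \<le> y" using \<open>a \<le> x\<close> xz(3) that(1) by simp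
        moreover from this have "z \<in> I" using xz(2,3) that(1) by auto
        ultimately show ?thesis
          using I xz(3) unfolding maximal_interval_def consecutive_def by blast
      qed simp
    qed simp
    then show ?thesis
      using I that unfolding maximal_interval_def by blast
  qed
  then show "b \<in> S \<and> (\<forall>a. b = Suc a \<longrightarrow> a \<notin> S)"
    using I unfolding maximal_interval_def by (metis Suc_n_not_le_n insertI1 subsetD)
next
  assume b: "b \<in> S \<and> (\<forall>a. b = Suc a \<longrightarrow> a \<notin> S)"
  define I where "I = {x. b \<le> x \<and> {b..x} \<subseteq> S}"
  have "consecutive I" "b \<in> I" "I \<subseteq> S"
    using b by (auto simp: consecutive_def I_def)
  moreover have "J \<subseteq> I" if J: "consecutive J" "I \<subseteq> J" "J \<subseteq> S" for J
  proof
    fix x assume x: "x \<in> J"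
    have bJ: "b \<in> J" using J \<open>b \<in> I\<close> by auto
    have "b \<le> x"
    proof (rule ccontr)
      assume "\<not> b \<le> x"
      then obtain a where a: "b = Suc a" "x \<le> a" by (cases b) auto
      then have "a \<in> J" using J(1) x bJ unfolding consecutive_def by (meson le_SucI order_refl)
      then show False using a b J by auto
    qed
    moreover have "{b..x} \<subseteq> J" using consecutiveD[OF J(1) bJ x] by auto
    ultimately show "x \<in> I" using J by (auto simp: I_def)
  qed
  ultimately have "maximal_interval S I" unfolding maximal_interval_def by blast
  then show "bottom_element S b"
    using \<open>b \<in> I\<close> unfolding bottom_element_def I_def by blast
qed

section \<open>Ordered partitions of arbitrary sets, given as lists\<close>

text \<open>The ground set is arbitrary because removing an item leaves a partition of
  \<open>X - K\<close>, which need not be an initial segment.\<close>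

definition partition_list :: "'a set \<Rightarrow> 'a set list \<Rightarrow> bool" where
  "partition_list X P \<longleftrightarrow>
     {} \<notin> set P \<and> sorted_wrt (\<lambda>C D. C \<inter> D = {}) P \<and> \<Union> (set P) = X"

lemma ordered_set_partition_iff: "ordered_set_partition n P \<longleftrightarrow> partition_list {1..n} P"
proof -
  have "(\<forall>i<length P. \<forall>j<length P. i \<noteq> j \<longrightarrow> P ! i \<inter> P ! j = {}) \<longleftrightarrow>
        sorted_wrt (\<lambda>C D. C \<inter> D = {}) P" (is "?L \<longleftrightarrow> ?R")
  proof
    assume ?R
    then have "P ! i \<inter> P ! j = {}" if "i < j" "j < length P" for i j
      using that by (simp add: sorted_wrt_iff_nth_less)
    then show ?L by (metis Int_commute nat_neq_iff)
  qed (simp add: sorted_wrt_iff_nth_less)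
  moreover have "(\<forall>i<length P. P ! i \<noteq> {}) \<longleftrightarrow> {} \<notin> set P"
    by (metis in_set_conv_nth)
  ultimately show ?thesis
    by (simp add: ordered_set_partition_def partition_list_def)
qed

lemma partition_list_append:
  "partition_list X (P @ R) \<longleftrightarrow>
     partition_list (\<Union> (set P)) P \<and> partition_list (\<Union> (set R)) R \<and>
     \<Union> (set P) \<inter> \<Union> (set R) = {} \<and> \<Union> (set P) \<union> \<Union> (set R) = X"
  by (auto simp: partition_list_def sorted_wrt_append)

lemma finite_partition_lists:
  assumes "finite X"
  shows "finite {P. partition_list X P}"
proof (rule finite_subset)
  have "distinct P" if "partition_list X P" for P
    using that unfolding partition_list_def
    by (induction P arbitrary: X) auto
  then show "{P. partition_list X P} \<subseteq> {P. set P \<subseteq> Pow X \<and> distinct P}"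
    by (auto simp: partition_list_def)
  show "finite {P. set P \<subseteq> Pow X \<and> distinct P}"
    by (rule finite_subset_distinct) (simp add: assms)
qed

section \<open>Descending runs of singletons\<close>

definition descending :: "nat set \<Rightarrow> nat set list" where
  "descending X = map (\<lambda>x. {x}) (rev (sorted_list_of_set X))"

lemma set_descending [simp]: "finite X \<Longrightarrow> set (descending X) = (\<lambda>x. {x}) ` X"
  by (simp add: descending_def)

lemma Union_descending [simp]: "finite X \<Longrightarrow> \<Union> (set (descending X)) = X"
  by auto

lemma descending_empty [simp]: "descending {} = []"
  by (simp add: descending_def)

lemma sorted_wrt_descending: "sorted_wrt (\<lambda>C D. Max D < Max C) (descending X)"
  using strict_sorted_list_of_set[of X]
  by (simp add: descending_def sorted_wrt_map sorted_wrt_rev)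

lemma partition_list_descending: "finite X \<Longrightarrow> partition_list X (descending X)"
  using strict_sorted_list_of_set[of X]
  by (auto simp: partition_list_def descending_def sorted_wrt_map sorted_wrt_rev
      intro: sorted_wrt_mono_rel[of _ "(<)"])

lemma descending_insert:
  assumes "finite X" "\<And>x. x \<in> X \<Longrightarrow> x < k"
  shows "descending (insert k X) = {k} # descending X"
proof -
  have "sorted_list_of_set (insert k X) = sorted_list_of_set X @ [k]"
    using assms by (subst sorted_list_of_set_insert) (auto intro!: sorted_insort_is_snoc simp: less_imp_le)
  then show ?thesis by (simp add: descending_def)
qed

lemma descending_Max:
  assumes "finite X" "X \<noteq> {}"
  shows "descending X = {Max X} # descending (X - {Max X})"
proof -
  have "descending (insert (Max X) (X - {Max X})) = {Max X} # descending (X - {Max X})"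
    by (rule descending_insert) (use assms in \<open>auto simp: le_neq_trans\<close>)
  then show ?thesis using assms by (simp add: insert_absorb)
qed

lemma descending_suffix:
  assumes "descending Y = R @ Q # descending Z" "finite Y" "finite Z"
  shows "card Q = 1" "z \<in> Z \<Longrightarrow> z < Max Q"
proof -
  have "Q \<in> set (descending Y)" using assms by simp
  then show "card Q = 1" using assms(2) by auto
  show "z < Max Q" if "z \<in> Z"
    using sorted_wrt_descending[of Y] that unfolding assms(1)
    by (auto simp: sorted_wrt_append assms)
qed

text \<open>The second case exhibits the shortest suffix that is not a descending run: all that
  follows its first block \<open>Q\<close> is such a run.\<close>

lemma descending_decomposition:
  assumes "finite (\<Union> (set P))"
  shows "P = descending (\<Union> (set P)) \<or>
    (\<exists>P' Q Y. P = P' @ Q # descending Y \<and> finite Y \<and> Q # descending Y \<noteq> descending (Q \<union> Y))"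
  using assms
proof (induction P)
  case (Cons R P)
  then have "finite (\<Union> (set P))" by simp
  with Cons consider "P = descending (\<Union> (set P))"
    | P' Q Y where "P = P' @ Q # descending Y" "finite Y" "Q # descending Y \<noteq> descending (Q \<union> Y)"
    by blast
  then show ?case
  proof cases
    case 1
    show ?thesis
    proof (cases "R # P = descending (R \<union> \<Union> (set P))")
      case True
      moreover have "\<Union> (set (R # P)) = R \<union> \<Union> (set P)" by simp
      ultimately have "R # P = descending (\<Union> (set (R # P)))" by metis
      then show ?thesis by blast
    next
      case False
      have "R # P = [] @ R # descending (\<Union> (set P)) \<and> finite (\<Union> (set P)) \<and>
        R # descending (\<Union> (set P)) \<noteq> descending (R \<union> \<Union> (set P))"
        using 1 False Cons.prems by auto
      then show ?thesis by blast
    qed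
  next
    case 2
    then have "R # P = (R # P') @ Q # descending Y" by simp
    with 2 show ?thesis by blast
  qed
qed simp

section \<open>Ascents and the freeze scan\<close>

text \<open>The order condition common to the freeze scan and the third clause of
  \<open>good\<close>, indexed by the left block.\<close>

definition ascent :: "nat set list \<Rightarrow> nat \<Rightarrow> bool" where
  "ascent P i \<longleftrightarrow> (\<exists>k. P ! Suc i = {k} \<and> k > Max (P ! i))"

lemma ascent_append:
  "ascent (P @ R) (length P + i) = ascent R i"
  "Suc i < length P \<Longrightarrow> ascent (P @ R) i = ascent P i"
  by (auto simp: ascent_def nth_append)

lemma ascent_Cons_Suc [simp]: "ascent (C # P) (Suc i) = ascent P i"
  by (simp add: ascent_def)

lemma not_ascent_descending:
  assumes "Suc i < length (descending Y)"
  shows "\<not> ascent (descending Y) i"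
  using sorted_wrt_descending[of Y] assms
  by (fastforce simp: ascent_def sorted_wrt_iff_nth_less)

lemma freeze_scan_Suc_Suc:
  "freeze_scan S P (Suc (Suc j)) =
     (if ascent P j \<and> Suc (card (P ! j)) \<notin> S
      then insert (j, Suc j) (freeze_scan S P j) else freeze_scan S P (Suc j))"
  by (simp add: ascent_def)

declare freeze_scan.simps(3) [simp del]

text \<open>A scan started at \<open>j\<close> reads only blocks of index below
  \<open>j\<close>.\<close>

lemma freeze_scan_append:
  "j \<le> length P \<Longrightarrow> freeze_scan S (P @ R) j = freeze_scan S P j"
proof (induction j rule: less_induct)
  case (less j)
  consider "j = 0" | "j = Suc 0" | i where "j = Suc (Suc i)" by (metis not0_implies_Suc)
  then show ?case
    using less by cases (simp_all add: freeze_scan_Suc_Suc ascent_append(2) nth_append)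
qed

lemma freeze_scan_bound: "(p, q) \<in> freeze_scan S P j \<Longrightarrow> q = Suc p \<and> q < j"
proof (induction j rule: less_induct)
  case (less j)
  consider "j = 0" | "j = Suc 0" | i where "j = Suc (Suc i)" by (metis not0_implies_Suc)
  then show ?case
  proof cases
    case 3
    with less.prems less.IH[of i] less.IH[of "Suc i"] show ?thesis
      by (auto simp: freeze_scan_Suc_Suc split: if_splits)
  qed (use less.prems in simp_all)
qed

text \<open>A block that forms no ascent with its left neighbour is merely passed over. The bound
  \<open>m \<le> Suc i\<close> includes the boundary just left of block \<open>m\<close>.\<close>

lemma freeze_scan_no_ascent:
  assumes "\<And>i. m \<le> Suc i \<Longrightarrow> Suc i < m + d \<Longrightarrow> \<not> ascent P i"
  shows "freeze_scan S P (m + d) = freeze_scan S P m"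
  using assms
proof (induction d)
  case (Suc d)
  have "freeze_scan S P (Suc (m + d)) = freeze_scan S P (m + d)"
  proof (cases "m + d")
    case (Suc j)
    then have "\<not> ascent P j" using Suc.prems[of j] by simp
    then show ?thesis by (simp add: Suc freeze_scan_Suc_Suc)
  qed simp
  with Suc show ?case by simp
qed simp

text \<open>No boundary inside the item is an ascent, and \<open>Q\<close>, not being a singleton,
  cannot pair with the last block of \<open>P\<close>. The scan therefore reaches \<open>P\<close>
  as if it started there.\<close>

lemma freeze_scan_bottom_item:
  assumes "card Q \<noteq> 1" "\<And>i. Suc i < length (Q # D) \<Longrightarrow> \<not> ascent (Q # D) i"
  shows "freeze_scan S (P @ Q # D) (length (P @ Q # D)) = freeze_scan S P (length P)"
proof -
  have "\<not> ascent (P @ Q # D) i" if i: "length P \<le> Suc i" "Suc i < length P + length (Q # D)" for i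
  proof (cases "length P \<le> i")
    case True
    then obtain j where "i = length P + j" using le_Suc_ex by blast
    with assms(2)[of j] i show ?thesis by (simp add: ascent_append)
  next
    case False
    then have "Suc i = length P" using i by simp
    then show ?thesis using assms(1) by (auto simp: ascent_def)
  qed
  then have "freeze_scan S (P @ Q # D) (length P + length (Q # D)) = freeze_scan S (P @ Q # D) (length P)"
    by (rule freeze_scan_no_ascent)
  then show ?thesis by (simp add: freeze_scan_append)
qed

text \<open>The scan passes over \<open>D\<close>, pairs \<open>Q\<close> with \<open>{k}\<close>
  and skips both, so it reaches \<open>P\<close> as if it started there. An ascent from the last
  block of \<open>P\<close> to \<open>Q\<close> is never examined.\<close>

lemma freeze_scan_top_item:
  assumes "Suc (card Q) \<notin> S" "k > Max Q"
    and "\<And>i. Suc i < length ({k} # D) \<Longrightarrow> \<not> ascent ({k} # D) i"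
  shows "freeze_scan S (P @ Q # {k} # D) (length (P @ Q # {k} # D)) =
    insert (length P, Suc (length P)) (freeze_scan S P (length P))"
proof -
  let ?P = "P @ Q # {k} # D"
  \<comment> \<open>The range starts beyond the boundary between \<open>Q\<close> and
    \<open>{k}\<close>, which is an ascent.\<close>
  have "\<not> ascent ?P i" if i: "length P + 2 \<le> Suc i" "Suc i < length P + 2 + length D" for i
  proof -
    from i(1) have "length P + 1 \<le> i" by simp
    then obtain j where "i = length P + 1 + j" using le_Suc_ex by blast
    then have j: "i = length P + Suc j" by simp
    show ?thesis using assms(3)[of j] i unfolding j ascent_append by simp
  qed
  then have "freeze_scan S ?P (length P + 2 + length D) = freeze_scan S ?P (length P + 2)"
    by (rule freeze_scan_no_ascent)
  moreover have "ascent ?P (length P)"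
    using assms(2) by (simp add: ascent_def nth_append)
  ultimately show ?thesis
    using assms(1) by (simp add: freeze_scan_append freeze_scan_Suc_Suc nth_append)
qed

section \<open>Goodness of a list with an item appended\<close>

text \<open>The clauses of \<open>good\<close> localised at one block, so that goodness splits along
  an append.\<close>

definition good_at :: "nat set \<Rightarrow> nat set \<Rightarrow> nat set list \<Rightarrow> nat \<Rightarrow> bool" where
  "good_at A B P i \<longleftrightarrow>
     (card (P ! i) = 1 \<or> top_element (A \<union> B) (card (P ! i)) \<or>
        bottom_element (A \<union> B) (card (P ! i))) \<and>
     (top_element (A \<union> B) (card (P ! i)) \<and> \<not> bottom_element (A \<union> B) (card (P ! i)) \<longrightarrow>
        in_freeze_skip_pair A B P i) \<and>
     \<not> (Suc i < length P \<and> bottom_element (A \<union> B) (card (P ! i)) \<and>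
        \<not> top_element (A \<union> B) (card (P ! i)) \<and> ascent P i \<and>
        \<not> in_freeze_skip_pair A B P (Suc i))"

lemma good_iff: "good A B P \<longleftrightarrow> (\<forall>i<length P. good_at A B P i)"
  unfolding good_def good_at_def ascent_def by (meson Suc_lessD)

lemma good_append_iff:
  "good A B (P @ R) \<longleftrightarrow>
     (\<forall>i<length P. good_at A B (P @ R) i) \<and>
     (\<forall>j<length R. good_at A B (P @ R) (length P + j))"
proof -
  have "(\<forall>i<m + n. Q i) \<longleftrightarrow> (\<forall>i<m. Q i) \<and> (\<forall>j<n. Q (m + j))" for Q and m n :: nat
    by (metis add_less_cancel_left le_Suc_ex linorder_not_less trans_less_add1)
  then show ?thesis unfolding good_iff by simp
qed

lemma not_in_freeze_skip_pair:
  assumes "freeze_scan (A \<union> B) P (length P) = freeze_scan (A \<union> B) R m" "m \<le> i"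
  shows "\<not> in_freeze_skip_pair A B P i"
proof
  assume "in_freeze_skip_pair A B P i"
  then obtain p q where "(p, q) \<in> freeze_scan (A \<union> B) R m" "i = p \<or> i = q"
    unfolding in_freeze_skip_pair_def freeze_skip_pairs_def assms(1) by blast
  then show False using freeze_scan_bound[of p q] assms(2) by fastforce
qed

text \<open>The freeze skip pairs are unchanged and no new ascent arises, since \<open>Q\<close> is
  no singleton. As 1 is a bottom element, the second clause of \<open>good\<close> never constrains
  the singletons in \<open>D\<close>.\<close>

lemma good_append_bottom_item:
  assumes Q: "card Q \<noteq> 1" "bottom_element (A \<union> B) (card Q)"
    and D: "\<And>i. Suc i < length (Q # D) \<Longrightarrow> \<not> ascent (Q # D) i" "\<And>C. C \<in> set D \<Longrightarrow> card C = 1"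
    and 1: "bottom_element (A \<union> B) 1"
  shows "good A B (P @ Q # D) \<longleftrightarrow> good A B P"
proof -
  have in_eq: "in_freeze_skip_pair A B (P @ Q # D) i = in_freeze_skip_pair A B P i" for i
    unfolding in_freeze_skip_pair_def freeze_skip_pairs_def
    by (simp only: freeze_scan_bottom_item[OF Q(1) D(1)])
  have "good_at A B (P @ Q # D) (length P + j)" if j: "j < length (Q # D)" for j
  proof -
    have "(Q # D) ! j = Q \<or> (Q # D) ! j \<in> set D" using j by (cases j) auto
    then have "bottom_element (A \<union> B) (card ((P @ Q # D) ! (length P + j)))"
      using Q D 1 by (auto simp: nth_append)
    moreover have "\<not> (Suc (length P + j) < length (P @ Q # D) \<and> ascent (P @ Q # D) (length P + j))"
      using D(1)[of j] j by (auto simp: ascent_append)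
    ultimately show ?thesis unfolding good_at_def by blast
  qed
  moreover have "good_at A B (P @ Q # D) i = good_at A B P i" if i: "i < length P" for i
  proof (cases "Suc i < length P")
    case True
    then show ?thesis by (auto simp: good_at_def in_eq nth_append ascent_append)
  next
    case False
    then have "Suc i = length P" using i by simp
    moreover from this have "\<not> ascent (P @ Q # D) i" using Q(1) by (auto simp: ascent_def)
    ultimately show ?thesis using i by (auto simp: good_at_def in_eq nth_append)
  qed
  ultimately show ?thesis unfolding good_append_iff by (auto simp: good_iff)
qed

text \<open>The pair formed by \<open>Q\<close> and \<open>{k}\<close> meets the second clause of
  \<open>good\<close> at \<open>Q\<close>. Here \<open>Q\<close> may be a singleton that ascends
  from the last block of \<open>P\<close>; lying in a freeze skip pair, it does not violate the
  third clause.\<close>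

lemma good_append_top_item:
  assumes Q: "top_element (A \<union> B) (card Q)" "k > Max Q"
    and D: "\<And>i. Suc i < length ({k} # D) \<Longrightarrow> \<not> ascent ({k} # D) i" "\<And>C. C \<in> set D \<Longrightarrow> card C = 1"
    and 1: "bottom_element (A \<union> B) 1"
  shows "good A B (P @ Q # {k} # D) \<longleftrightarrow> good A B P"
proof -
  let ?P = "P @ Q # {k} # D"
  have Q': "Suc (card Q) \<notin> A \<union> B" using Q(1) by (simp add: top_element_iff)
  have in_eq: "in_freeze_skip_pair A B ?P i \<longleftrightarrow>
      i = length P \<or> i = Suc (length P) \<or> in_freeze_skip_pair A B P i" for i
    unfolding in_freeze_skip_pair_def freeze_skip_pairs_def
    by (simp only: freeze_scan_top_item[OF Q' Q(2) D(1)]) auto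
  have "good_at A B ?P (length P + j)" if j: "j < length (Q # {k} # D)" for j
  proof (cases j)
    case 0
    then show ?thesis using Q(1) by (auto simp: good_at_def in_eq)
  next
    case (Suc l)
    have "({k} # D) ! l = {k} \<or> ({k} # D) ! l \<in> set D" using j Suc by (cases l) auto
    then have "bottom_element (A \<union> B) (card (?P ! (length P + j)))"
      using D 1 Suc by (auto simp: nth_append)
    moreover have "\<not> (Suc (length P + j) < length ?P \<and> ascent ?P (length P + j))"
      using D(1)[of l] j Suc unfolding ascent_append by auto
    ultimately show ?thesis unfolding good_at_def by blast
  qed
  moreover have "good_at A B ?P i = good_at A B P i" if i: "i < length P" for i
  proof (cases "Suc i < length P")
    case True
    then show ?thesis by (auto simp: good_at_def in_eq nth_append ascent_append)
  next
    case False
    then have "Suc i = length P" using i by simp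
    then show ?thesis using i by (auto simp: good_at_def in_eq nth_append)
  qed
  ultimately show ?thesis unfolding good_append_iff by (auto simp: good_iff)
qed

lemma good_descending:
  assumes "bottom_element (A \<union> B) 1" "finite X"
  shows "good A B (descending X)"
proof -
  have "card (descending X ! i) = 1" if "i < length (descending X)" for i
    using nth_mem[OF that] assms(2) by auto
  then show ?thesis
    using assms(1) not_ascent_descending by (auto simp: good_iff good_at_def)
qed

section \<open>Items and the unique last item\<close>

text \<open>The condition \<open>card Q \<noteq> 1\<close> excludes the head \<open>{Max K}\<close>,
  which would only begin a descending run of singletons.\<close>

definition item_heads :: "nat set \<Rightarrow> nat set \<Rightarrow> nat set set" where
  "item_heads S K = {Q. Q \<subseteq> K \<and>
     (if Max K \<in> Q then card Q \<noteq> 1 \<and> bottom_element S (card Q) else top_element S (card Q))}"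

definition items :: "nat set \<Rightarrow> nat set \<Rightarrow> nat set list set" where
  "items S K = (\<lambda>Q. Q # descending (K - Q)) ` item_heads S K"

text \<open>In a descending run \<open>Q\<close> would be a singleton, so
  \<open>Max K \<notin> Q\<close>; then \<open>{Max K}\<close> would come after \<open>Q\<close> and
  force \<open>Max K < Max Q\<close>, although \<open>Q \<subseteq> K\<close>.\<close>

lemma item_not_descending_suffix:
  assumes "Q \<in> item_heads S K" "finite K" "K \<noteq> {}" "finite Y"
  shows "descending Y \<noteq> R @ Q # descending (K - Q)"
proof
  assume *: "descending Y = R @ Q # descending (K - Q)"
  note suffix = descending_suffix[OF * \<open>finite Y\<close> finite_Diff[OF \<open>finite K\<close>]]
  have "Max K \<notin> Q" using suffix(1) assms(1) by (auto simp: item_heads_def)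
  then have "Max K < Max Q" using assms suffix(2)[of "Max K"] by auto
  moreover have "Q \<noteq> {}" using suffix(1) by auto
  then have "Max Q \<le> Max K" using assms by (auto simp: item_heads_def intro: Max_mono)
  ultimately show False by simp
qed

text \<open>If the two heads stood at different positions, one item would be a suffix of the
  descending tail of the other. Once the heads agree, the union of the blocks determines
  \<open>K\<close>.\<close>

lemma append_item_inject:
  assumes "P @ Q # descending (K - Q) = P' @ Q' # descending (K' - Q')"
    and Q: "Q \<in> item_heads S K" "finite K" "K \<noteq> {}"
    and Q': "Q' \<in> item_heads S K'" "finite K'" "K' \<noteq> {}"
  shows "P = P' \<and> Q = Q' \<and> K = K'"
proof -
  from assms(1) obtain us where
    us: "P = P' @ us \<and> us @ Q # descending (K - Q) = Q' # descending (K' - Q') \<or>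
         P @ us = P' \<and> Q # descending (K - Q) = us @ Q' # descending (K' - Q')"
    unfolding append_eq_append_conv2 by blast
  have "us = []"
  proof (rule ccontr)
    assume "us \<noteq> []"
    then obtain u R where "us = u # R" by (cases us) auto
    with us have "descending (K' - Q') = R @ Q # descending (K - Q) \<or>
      descending (K - Q) = R @ Q' # descending (K' - Q')" by auto
    then show False
      using item_not_descending_suffix[OF Q finite_Diff[OF Q'(2)]]
        item_not_descending_suffix[OF Q' finite_Diff[OF Q(2)]] by blast
  qed
  with us have eq: "P = P'" "Q = Q'" "descending (K - Q) = descending (K' - Q')" by auto
  then have "K - Q = K' - Q'"
    using Q Q' by (metis Union_descending finite_Diff)
  then show ?thesis using eq Q Q' by (auto simp: item_heads_def)
qed

text \<open>If \<open>Max K \<in> Q\<close>, the item contains no ascent. Otherwise its tail starts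
  with \<open>{Max K}\<close>, and the only ascent is the one directly after \<open>Q\<close>. These
  are the two situations of the append lemmas.\<close>

lemma item_properties:
  assumes I: "I \<in> items (A \<union> B) K" and K: "finite K" "K \<noteq> {}"
    and S: "0 \<notin> A \<union> B" "1 \<in> A \<union> B"
  shows "partition_list K I" "good A B (P @ I) \<longleftrightarrow> good A B P"
proof -
  from I obtain Q where Q: "Q \<in> item_heads (A \<union> B) K" and I_def: "I = Q # descending (K - Q)"
    by (auto simp: items_def)
  have QK: "Q \<subseteq> K" using Q by (simp add: item_heads_def)
  have fin: "finite (K - Q)" "finite Q" using K QK finite_subset by auto
  have "card Q \<in> A \<union> B"
    using Q by (auto simp: item_heads_def top_element_iff bottom_element_iff split: if_splits)
  then have "card Q \<noteq> 0" using S(1) by metis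
  then have "Q \<noteq> {}" by auto
  then show "partition_list K I"
    using partition_list_descending[OF fin(1)] QK fin by (auto simp: partition_list_def I_def)
  have 1: "bottom_element (A \<union> B) 1" using S by (simp add: bottom_element_iff)
  have single: "card C = 1" if "C \<in> set (descending (K - Q))" for C
    using that fin by auto
  show "good A B (P @ I) \<longleftrightarrow> good A B P"
  proof (cases "Max K \<in> Q")
    case True
    have "\<not> ascent (Q # descending (K - Q)) i" if "Suc i < length (Q # descending (K - Q))" for i
    proof (cases i)
      case 0
      with that have "descending (K - Q) ! 0 \<in> set (descending (K - Q))" by (intro nth_mem) simp
      then obtain x where x: "descending (K - Q) ! 0 = {x}" "x \<in> K" using fin by auto
      have "Max K \<le> Max Q" using True fin by simp
      then show ?thesis using x K 0 by (auto simp: ascent_def dest: Max_ge[of K x])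
    next
      case (Suc j)
      then show ?thesis using not_ascent_descending[of j "K - Q"] that by simp
    qed
    then show ?thesis unfolding I_def
      using Q True single 1 by (intro good_append_bottom_item) (auto simp: item_heads_def)
  next
    case False
    then have MK: "Max K \<in> K - Q" using K by simp
    then have "Max (K - Q) = Max K" using K fin by (intro Max_eqI) auto
    then have desc: "descending (K - Q) = {Max K} # descending (K - Q - {Max K})"
      using descending_Max[of "K - Q"] fin MK by auto
    have "Max Q \<in> K" "Max Q \<noteq> Max K" using False fin \<open>Q \<noteq> {}\<close> QK Max_in by fastforce+
    then have less: "Max Q < Max K" using K by (simp add: le_neq_trans)
    have nd: "\<not> ascent ({Max K} # descending (K - Q - {Max K})) i"
      if "Suc i < length ({Max K} # descending (K - Q - {Max K}))" for i
      using not_ascent_descending[of i "K - Q"] that unfolding desc[symmetric] by simp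
    show ?thesis unfolding I_def desc
      using Q False single 1 less nd unfolding desc
      by (intro good_append_top_item) (auto simp: item_heads_def)
  qed
qed

text \<open>The shortest suffix that is not a descending run is an item. Comparing
  \<open>Max Q\<close> with \<open>Max Y\<close> decides whether \<open>Max K\<close> lies in
  \<open>Q\<close>, and goodness at \<open>Q\<close> then forces the size required of a
  head.\<close>

lemma good_decomposition:
  assumes P: "partition_list X P" "good A B P" and X: "finite X"
    and S: "0 \<notin> A \<union> B" "1 \<in> A \<union> B"
  shows "P = descending X \<or> (\<exists>K P' I. K \<noteq> {} \<and> K \<subseteq> X \<and> P = P' @ I \<and> I \<in> items (A \<union> B) K)"
proof (cases "P = descending X")
  case False
  have UP: "\<Union> (set P) = X" using P by (simp add: partition_list_def)
  with False descending_decomposition[of P] X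
  obtain P' Q Y where P_eq: "P = P' @ Q # descending Y" and Y: "finite Y"
    and nd: "Q # descending Y \<noteq> descending (Q \<union> Y)" by auto
  have "partition_list (\<Union> (set (Q # descending Y))) (Q # descending Y)"
    using P(1) unfolding P_eq partition_list_append by blast
  then have Q: "Q \<noteq> {}" "Q \<inter> Y = {}"
    using Y by (auto simp: partition_list_def)
  have KX: "Q \<union> Y \<subseteq> X" using UP Y by (auto simp: P_eq)
  then have Qfin: "finite Q" using X finite_subset by auto
  define n where "n = length P'"
  have nQ: "P ! n = Q" "n < length P" by (auto simp: P_eq n_def)
  have good_n: "good_at A B P n" using P(2) nQ by (simp add: good_iff)
  \<comment> \<open>Size 1 is covered as well, being a bottom element because 1 is in the union and
    0 is not.\<close>
  have top1: "top_element (A \<union> B) (card Q) \<or> bottom_element (A \<union> B) (card Q)"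
    using good_n S nQ by (auto simp: good_at_def bottom_element_iff)
  have K_Q: "Q \<union> Y - Q = Y" using Q by auto
  have "Q \<in> item_heads (A \<union> B) (Q \<union> Y)"
  proof (cases "Y \<noteq> {} \<and> Max Y > Max Q")
    case True
    then have MY: "Max Y \<in> Y" "Max Y \<notin> Q" using Y Q by (auto dest: Max_in)
    have MK: "Max (Q \<union> Y) = Max Y"
    proof (rule Max_eqI)
      fix y assume "y \<in> Q \<union> Y"
      then show "y \<le> Max Y"
      proof
        assume "y \<in> Q"
        then have "y \<le> Max Q" using Qfin by simp
        then show ?thesis using True by linarith
      qed (use Y in simp)
    qed (use Y Qfin MY in simp_all)
    have desc: "descending Y = {Max Y} # descending (Y - {Max Y})"
      using descending_Max Y True by auto
    have asc: "Suc n < length P" "ascent P n"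
      using True by (auto simp: P_eq n_def ascent_def nth_append desc)
    have "top_element (A \<union> B) (card Q)"
    proof (rule ccontr)
      assume nt: "\<not> top_element (A \<union> B) (card Q)"
      then have bot: "bottom_element (A \<union> B) (card Q)" using top1 by simp
      then have S': "Suc (card Q) \<in> A \<union> B" using nt by (auto simp: top_element_iff bottom_element_iff)
      have na: "\<not> ascent P i" if "n + 2 \<le> Suc i" "Suc i < n + 2 + length (descending (Y - {Max Y}))" for i
      proof -
        from that have "n + 1 \<le> i" by simp
        then obtain j where "i = n + 1 + j" using le_Suc_ex by blast
        then have j: "i = length P' + Suc j" by (simp add: n_def)
        show ?thesis
          using not_ascent_descending[of j Y] that
          unfolding P_eq j ascent_append by (simp add: n_def desc)
      qed
      \<comment> \<open>At the ascent after \<open>Q\<close> the scan rejects the pair by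
        \<open>S'\<close>, so block \<open>Suc n\<close> stays unpaired, against the third clause of
        \<open>good\<close>.\<close>
      have "freeze_scan (A \<union> B) P (n + 2 + length (descending (Y - {Max Y}))) =
          freeze_scan (A \<union> B) P (n + 2)"
        by (rule freeze_scan_no_ascent) (rule na)
      also have "\<dots> = freeze_scan (A \<union> B) P (Suc n)"
        using S' nQ by (simp add: freeze_scan_Suc_Suc)
      finally have "freeze_scan (A \<union> B) P (length P) = freeze_scan (A \<union> B) P (Suc n)"
        by (simp add: P_eq n_def desc)
      then have "\<not> in_freeze_skip_pair A B P (Suc n)"
        by (rule not_in_freeze_skip_pair) simp
      then show False using good_n asc nt bot nQ by (auto simp: good_at_def)
    qed
    then show ?thesis using MY by (simp add: item_heads_def MK)
  next
    case False
    have le: "y < Max Q" if "y \<in> Y" for y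
    proof -
      have "Max Y \<le> Max Q" "y \<le> Max Y" using that False Y by auto
      moreover have "Max Q \<in> Q" using Q Qfin by simp
      ultimately show ?thesis using that Q by (metis IntI empty_iff le_trans order_le_less)
    qed
    have MK: "Max (Q \<union> Y) = Max Q"
      using le Y Q Qfin by (intro Max_eqI) (auto simp: less_imp_le)
    \<comment> \<open>A singleton above all of \<open>Y\<close> would prolong the descending run,
      contradicting \<open>nd\<close>.\<close>
    have "card Q \<noteq> 1"
    proof
      assume "card Q = 1"
      then obtain q where q: "Q = {q}" by (auto simp: card_1_singleton_iff)
      then show False using nd descending_insert[of Y q] le Y by auto
    qed
    have na: "\<not> ascent (Q # descending Y) i" if "Suc i < length (Q # descending Y)" for i
    proof (cases i)
      case 0
      then have "Y \<noteq> {}" using that by auto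
      then have "descending Y ! 0 = {Max Y}" "Max Y \<in> Y" using descending_Max[of Y] Y by auto
      then show ?thesis using 0 le by (fastforce simp: ascent_def)
    next
      case (Suc j)
      then show ?thesis using not_ascent_descending[of j Y] that by simp
    qed
    \<comment> \<open>All pairs lie within \<open>P'\<close>, so \<open>Q\<close> is unpaired and
      the second clause of \<open>good\<close> leaves only bottom sizes.\<close>
    have "freeze_scan (A \<union> B) P (length P) = freeze_scan (A \<union> B) P' (length P')"
      unfolding P_eq by (rule freeze_scan_bottom_item) (use \<open>card Q \<noteq> 1\<close> na in auto)
    then have "\<not> in_freeze_skip_pair A B P n"
      by (rule not_in_freeze_skip_pair) (simp add: n_def)
    then have "bottom_element (A \<union> B) (card Q)"
      using good_n top1 nQ by (auto simp: good_at_def)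
    then show ?thesis
      using \<open>card Q \<noteq> 1\<close> Q Qfin by (simp add: item_heads_def MK)
  qed
  then have "Q # descending Y \<in> items (A \<union> B) (Q \<union> Y)"
    unfolding items_def using K_Q by (auto intro!: image_eqI[of _ _ Q])
  then show ?thesis using P_eq KX Q by blast
qed simp

section \<open>The recursion for the number of good partitions\<close>

lemma good_partition_lists_eq:
  assumes X: "finite X" and S: "0 \<notin> A \<union> B" "1 \<in> A \<union> B"
  shows "{P. partition_list X P \<and> good A B P} =
    insert (descending X) (\<Union>K \<in> Pow X - {{}}.
      (\<lambda>(P, I). P @ I) ` ({P. partition_list (X - K) P \<and> good A B P} \<times> items (A \<union> B) K))"
    (is "?L = insert _ (\<Union>K \<in> _. ?R K)")
proof (intro equalityI subsetI)
  fix P assume "P \<in> ?L"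
  then have P: "partition_list X P" "good A B P" by auto
  from good_decomposition[OF P X S]
  show "P \<in> insert (descending X) (\<Union>K \<in> Pow X - {{}}. ?R K)"
  proof
    assume "\<exists>K P' I. K \<noteq> {} \<and> K \<subseteq> X \<and> P = P' @ I \<and> I \<in> items (A \<union> B) K"
    then obtain K P' I where K: "K \<noteq> {}" "K \<subseteq> X" and P_eq: "P = P' @ I" and I: "I \<in> items (A \<union> B) K"
      by blast
    have fin: "finite K" using K X finite_subset by blast
    note props = item_properties[OF I fin K(1) S]
    have "\<Union> (set I) = K" using props(1) by (simp add: partition_list_def)
    then have "partition_list (X - K) P'"
      using P(1) unfolding P_eq partition_list_append
      by (metis Diff_cancel Diff_triv Un_Diff Un_empty_right)
    then have "P \<in> ?R K" using P(2) props(2) I unfolding P_eq by auto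
    then show ?thesis using K by blast
  qed simp
next
  fix P assume "P \<in> insert (descending X) (\<Union>K \<in> Pow X - {{}}. ?R K)"
  then show "P \<in> ?L"
  proof
    assume "P = descending X"
    then show ?thesis
      using good_descending[OF _ X] partition_list_descending[OF X] S by (simp add: bottom_element_iff)
  next
    assume "P \<in> (\<Union>K \<in> Pow X - {{}}. ?R K)"
    then obtain K P' I where K: "K \<noteq> {}" "K \<subseteq> X" and P_eq: "P = P' @ I"
      and I: "I \<in> items (A \<union> B) K" and P': "partition_list (X - K) P'" "good A B P'"
      by auto
    have fin: "finite K" using K X finite_subset by blast
    note props = item_properties[OF I fin K(1) S]
    have "\<Union> (set I) = K" "\<Union> (set P') = X - K"
      using props(1) P'(1) by (simp_all add: partition_list_def)
    then have "partition_list X P"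
      unfolding P_eq partition_list_append using props(1) P'(1) K by auto
    then show ?thesis using props(2) P' P_eq by simp
  qed
qed

lemma card_items: "card (items S K) = card (item_heads S K)"
  unfolding items_def by (rule card_image) (simp add: inj_on_def)

lemma finite_items: "finite K \<Longrightarrow> finite (items S K)"
  unfolding items_def item_heads_def by simp

text \<open>The last item determines \<open>K\<close> and the remaining list, so the union over
  \<open>K\<close> is disjoint and each append map is injective. \<open>descending X\<close> is
  counted separately, as it has no item as a suffix.\<close>

lemma card_good_partition_lists:
  assumes X: "finite X" and S: "0 \<notin> A \<union> B" "1 \<in> A \<union> B"
  shows "card {P. partition_list X P \<and> good A B P} =
    Suc (\<Sum>K \<in> Pow X - {{}}. card {P. partition_list (X - K) P \<and> good A B P} *
      card (item_heads (A \<union> B) K))"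
proof -
  let ?G = "\<lambda>X. {P. partition_list X P \<and> good A B P}"
  let ?R = "\<lambda>K. (\<lambda>(P, I). P @ I) ` (?G (X - K) \<times> items (A \<union> B) K)"
  have finG: "finite (?G Y)" if "Y \<subseteq> X" for Y
    using finite_partition_lists[of Y] finite_subset[OF that X] by simp
  have finK: "finite K" if "K \<in> Pow X - {{}}" for K
    using that X finite_subset by blast
  have fin: "finite (?R K)" if "K \<in> Pow X - {{}}" for K
    using finG[of "X - K"] finite_items[OF finK[OF that]] by blast
  have notin: "descending X \<notin> (\<Union>K \<in> Pow X - {{}}. ?R K)"
  proof
    assume "descending X \<in> (\<Union>K \<in> Pow X - {{}}. ?R K)"
    then obtain K P Q where "K \<in> Pow X - {{}}" "Q \<in> item_heads (A \<union> B) K"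
      "descending X = P @ Q # descending (K - Q)"
      by (auto simp: items_def)
    then show False using item_not_descending_suffix[of Q _ K X P] finK X by blast
  qed
  have inj: "inj_on (\<lambda>(P, I). P @ I) (?G (X - K) \<times> items (A \<union> B) K)" if K: "K \<in> Pow X - {{}}" for K
  proof (rule inj_onI, clarify)
    fix P I P' I' assume "I \<in> items (A \<union> B) K" "I' \<in> items (A \<union> B) K" and eq: "P @ I = P' @ I'"
    then obtain Q Q' where Q: "Q \<in> item_heads (A \<union> B) K" "I = Q # descending (K - Q)"
      and Q': "Q' \<in> item_heads (A \<union> B) K" "I' = Q' # descending (K - Q')"
      by (auto simp: items_def)
    have "P = P' \<and> Q = Q' \<and> K = K"
      using append_item_inject[OF eq[unfolded Q(2) Q'(2)] Q(1) _ _ Q'(1)] finK[OF K] K by blast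
    then show "P = P' \<and> I = I'" using Q(2) Q'(2) by simp
  qed
  have disj: "?R K \<inter> ?R K' = {}" if K: "K \<in> Pow X - {{}}" "K' \<in> Pow X - {{}}" "K \<noteq> K'" for K K'
  proof -
    have "False" if "P @ Q # descending (K - Q) = P' @ Q' # descending (K' - Q')"
      "Q \<in> item_heads (A \<union> B) K" "Q' \<in> item_heads (A \<union> B) K'" for P P' Q Q'
      using append_item_inject[OF that(1,2) _ _ that(3)] K finK by blast
    then show ?thesis unfolding items_def by fastforce
  qed
  have "card (?G X) = Suc (card (\<Union>K \<in> Pow X - {{}}. ?R K))"
    unfolding good_partition_lists_eq[OF X S]
    by (rule card_insert_disjoint) (use fin X notin in auto)
  also have "card (\<Union>K \<in> Pow X - {{}}. ?R K) = (\<Sum>K \<in> Pow X - {{}}. card (?R K))"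
    by (rule card_UN_disjoint) (use fin X disj in auto)
  also have "\<dots> = (\<Sum>K \<in> Pow X - {{}}. card (?G (X - K)) * card (item_heads (A \<union> B) K))"
    by (rule sum.cong[OF refl]) (simp add: card_image[OF inj] card_cartesian_product card_items)
  finally show ?thesis .
qed

section \<open>Binomial sums and the number of items\<close>

lemma sum_Pow_card:
  fixes f :: "nat \<Rightarrow> 'b :: semiring_1"
  assumes "finite X"
  shows "(\<Sum>K \<in> Pow X. f (card K)) = (\<Sum>k\<le>card X. of_nat (card X choose k) * f k)"
proof -
  have "(\<Sum>K \<in> Pow X. f (card K)) = (\<Sum>k\<le>card X. \<Sum>K | K \<in> Pow X \<and> card K = k. f (card K))"
    by (rule sum.group[symmetric]) (use assms in \<open>auto intro: card_mono\<close>)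
  also have "\<dots> = (\<Sum>k\<le>card X. of_nat (card X choose k) * f k)"
    by (rule sum.cong) (use n_subsets[OF assms] in simp_all)
  finally show ?thesis .
qed

text \<open>Deleting \<open>Max K\<close> from the heads that contain it turns both kinds of heads
  into subsets of the other \<open>m\<close> elements. The condition \<open>i \<noteq> 0\<close> is
  \<open>card Q \<noteq> 1\<close> after this shift.\<close>

lemma card_item_heads:
  assumes K: "finite K" "card K = Suc m"
  shows "card (item_heads S K) =
    (\<Sum>i\<le>m. (m choose i) * (of_bool (top_element S i) + of_bool (i \<noteq> 0 \<and> bottom_element S (Suc i))))"
proof -
  let ?M = "Max K" and ?Y = "K - {Max K}"
  have ne: "K \<noteq> {}" using K by auto
  have M: "?M \<in> K" using K ne by simp
  have Y: "finite ?Y" "card ?Y = m" using K M by auto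
  let ?T = "{Q \<in> Pow ?Y. top_element S (card Q)}"
  let ?U = "{Q \<in> Pow ?Y. card Q \<noteq> 0 \<and> bottom_element S (Suc (card Q))}"
  have card_ins: "card (insert ?M Q) = Suc (card Q)" if "Q \<subseteq> ?Y" for Q
  proof -
    have "finite Q" "?M \<notin> Q" using that Y finite_subset by auto
    then show ?thesis by simp
  qed
  have "item_heads S K = ?T \<union> insert ?M ` ?U"
  proof (intro equalityI subsetI)
    fix Q assume Q: "Q \<in> item_heads S K"
    show "Q \<in> ?T \<union> insert ?M ` ?U"
    proof (cases "?M \<in> Q")
      case True
      have "Q - {?M} \<subseteq> ?Y" using Q by (auto simp: item_heads_def)
      moreover have eq: "insert ?M (Q - {?M}) = Q" using True by auto
      ultimately have "Q - {?M} \<in> ?U" using Q True card_ins[of "Q - {?M}"]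
        by (auto simp: item_heads_def)
      then have "insert ?M (Q - {?M}) \<in> insert ?M ` ?U" by (rule imageI)
      then show ?thesis unfolding eq by (rule UnI2)
    qed (use Q in \<open>auto simp: item_heads_def\<close>)
  next
    fix Q assume "Q \<in> ?T \<union> insert ?M ` ?U"
    then show "Q \<in> item_heads S K"
      using M by (auto simp: item_heads_def card_ins)
  qed
  moreover have "card (?T \<union> insert ?M ` ?U) = card ?T + card (insert ?M ` ?U)"
    by (rule card_Un_disjoint) (use Y in auto)
  moreover have "card (insert ?M ` ?U) = card ?U"
    by (rule card_image) (auto simp: inj_on_def)
  moreover have "card {Q \<in> Pow ?Y. f (card Q)} = (\<Sum>i\<le>m. (m choose i) * of_bool (f i))" for f
  proof -
    have "card {Q \<in> Pow ?Y. f (card Q)} = (\<Sum>Q \<in> Pow ?Y. of_bool (f (card Q)))"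
      using Y by (simp add: Int_def)
    also have "\<dots> = (\<Sum>i\<le>m. (m choose i) * of_bool (f i))"
      using sum_Pow_card[OF Y(1), of "\<lambda>i. of_bool (f i) :: nat"] Y by simp
    finally show ?thesis .
  qed
  ultimately show ?thesis by (simp add: sum.distrib distrib_left)
qed

text \<open>Pascal's rule groups the signed indicator into sums of neighbouring values, which cancel
  except at the ends of maximal intervals.\<close>

lemma alternating_choose_sum:
  fixes S :: "nat set"
  assumes S: "0 \<notin> S" "1 \<in> S" "odd_ended S"
  shows "(\<Sum>i\<le>Suc m. of_nat (Suc m choose i) * ((-1) ^ i * of_bool (i \<in> insert 0 S))) =
    - real (\<Sum>i\<le>m. (m choose i) * (of_bool (top_element S i) + of_bool (i \<noteq> 0 \<and> bottom_element S (Suc i))))"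
proof -
  define h :: "nat \<Rightarrow> real" where "h i = (-1) ^ i * of_bool (i \<in> insert 0 S)" for i
  have "(\<Sum>i\<le>Suc m. of_nat (Suc m choose i) * h i) =
      h 0 + (\<Sum>i\<le>m. of_nat (Suc m choose Suc i) * h (Suc i))"
    by (simp only: sum.atMost_Suc_shift) simp
  also have "\<dots> = (h 0 + (\<Sum>i\<le>m. of_nat (m choose Suc i) * h (Suc i))) + (\<Sum>i\<le>m. of_nat (m choose i) * h (Suc i))"
    by (simp add: algebra_simps sum.distrib)
  \<comment> \<open>Shifting back gives a sum up to \<open>Suc m\<close>, whose last coefficient
    \<open>m choose Suc m\<close> is 0.\<close>
  also have "h 0 + (\<Sum>i\<le>m. of_nat (m choose Suc i) * h (Suc i)) = (\<Sum>i\<le>Suc m. of_nat (m choose i) * h i)"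
    by (simp only: sum.atMost_Suc_shift) simp
  also have "\<dots> = (\<Sum>i\<le>m. of_nat (m choose i) * h i)" by simp
  also have "\<dots> + (\<Sum>i\<le>m. of_nat (m choose i) * h (Suc i)) = (\<Sum>i\<le>m. of_nat (m choose i) * (h i + h (Suc i)))"
    by (simp add: algebra_simps sum.distrib)
  also have "\<dots> = (\<Sum>i\<le>m. of_nat (m choose i) *
      - of_nat (of_bool (top_element S i) + of_bool (i \<noteq> 0 \<and> bottom_element S (Suc i))))"
  proof (intro sum.cong refl arg_cong2[where f = "(*)"])
    fix i
    have "odd i" if "i \<in> S" "Suc i \<notin> S"
      using that S(3) unfolding odd_ended_def top_element_iff by blast
    moreover have "even i" if "i \<notin> S" "Suc i \<in> S"
      using that S(3) unfolding odd_ended_def bottom_element_iff by (metis even_Suc nat.inject)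
    \<comment> \<open>Odd endpoints give every surviving term the sign -1. At \<open>i = 0\<close>
      the values 1 and -1 cancel, in accordance with the excluded bottom 1.\<close>
    ultimately show "h i + h (Suc i) =
      - of_nat (of_bool (top_element S i) + of_bool (i \<noteq> 0 \<and> bottom_element S (Suc i)))"
      using S(1,2) by (cases "i = 0") (auto simp: h_def top_element_iff bottom_element_iff)
  qed
  also have "\<dots> = - real (\<Sum>i\<le>m. (m choose i) *
      (of_bool (top_element S i) + of_bool (i \<noteq> 0 \<and> bottom_element S (Suc i))))"
    unfolding of_nat_sum sum_negf[symmetric] by (intro sum.cong refl) (simp only: of_nat_mult mult_minus_right)
  finally show ?thesis unfolding h_def .
qed

section \<open>Comparison with the reciprocal power series\<close>

theorem theorem1p4:
  fixes A B :: "nat set" and c :: "nat \<Rightarrow> real"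
  assumes "A \<subseteq> {a. odd a}"
    and "B \<subseteq> {b. even b \<and> b > 0}"
    and "1 \<in> A"
    and "odd_ended (A \<union> B)"
    and "inverse (1 - set_egf A + set_egf B) = Abs_fps (\<lambda>n. c n / fact n)"
  shows "(\<forall>n. c n \<in> \<nat>) \<and>
    (\<forall>n. c n = real (card {P. ordered_set_partition n P \<and> good A B P}))"
proof -
  let ?S = "A \<union> B"
  have S: "0 \<notin> ?S" "1 \<in> ?S" using assms(1-3) by auto
  define F where "F = 1 - set_egf A + set_egf B"
  define C where "C = Abs_fps (\<lambda>n. c n / fact n)"
  \<comment> \<open>The sign merges the odd sizes in \<open>A\<close> with the even sizes in
    \<open>B\<close>; inserting 0 accounts for the constant term 1.\<close>
  define h :: "nat \<Rightarrow> real" where "h i = (-1) ^ i * of_bool (i \<in> insert 0 ?S)" for i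
  define d where "d n = (\<Sum>i\<le>n. of_nat (n choose i) * h i)" for n
  have F_nth: "fps_nth F i = h i / fact i" for i
  proof (cases "i = 0")
    case False
    have "\<not> (i \<in> A \<and> i \<in> B)" "i \<in> A \<Longrightarrow> odd i" "i \<in> B \<Longrightarrow> even i"
      using assms(1,2) by auto
    with False show ?thesis by (auto simp: F_def set_egf_def h_def)
  qed (use S in \<open>simp add: F_def set_egf_def h_def\<close>)
  \<comment> \<open>The constant term of \<open>F\<close> is 1, so \<open>inverse\<close> is a true
    reciprocal.\<close>
  have FC: "F * C = 1"
    using assms(5) F_nth[of 0] inverse_mult_eq_1'[of F] by (simp add: F_def C_def h_def)
  have E: "fps_nth (fps_exp 1 * F) n = d n / fact n" for n
  proof -
    have "fps_nth (F * fps_exp 1) n = (\<Sum>i\<le>n. h i / fact i * (1 / fact (n - i)))"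
      by (simp add: fps_mult_nth F_nth atLeast0AtMost)
    also have "\<dots> = (\<Sum>i\<le>n. of_nat (n choose i) * h i / fact n)"
      by (rule sum.cong) (auto simp: binomial_fact field_simps)
    finally show ?thesis by (simp add: d_def sum_divide_distrib mult.commute)
  qed
  \<comment> \<open>Coefficient comparison in \<open>fps_exp 1 * F * C = fps_exp 1\<close>, where
    \<open>d\<close> gives the exponential coefficients of \<open>fps_exp 1 * F\<close>.\<close>
  have conv: "(\<Sum>k\<le>n. of_nat (n choose k) * (d k * c (n - k))) = 1" for n
  proof -
    have "fps_nth (fps_exp 1 * F * C) n = (\<Sum>k\<le>n. d k / fact k * (c (n - k) / fact (n - k)))"
      by (simp add: fps_mult_nth[of "fps_exp 1 * F"] E C_def atLeast0AtMost)
    also have "\<dots> = (\<Sum>k\<le>n. of_nat (n choose k) * (d k * c (n - k)) / fact n)"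
      by (rule sum.cong) (auto simp: binomial_fact field_simps)
    also have "fps_exp 1 * F * C = fps_exp 1" by (simp add: mult.assoc FC)
    finally show ?thesis by (simp add: sum_divide_distrib[symmetric] field_simps)
  qed
  have d0: "d 0 = 1" by (simp add: d_def h_def)
  have heads: "real (card (item_heads ?S K)) = - d (card K)" if "finite K" "K \<noteq> {}" for K
  proof -
    from that obtain m where m: "card K = Suc m" by (metis card_0_eq not0_implies_Suc)
    show ?thesis
      unfolding card_item_heads[OF that(1) m] d_def m h_def
      using alternating_choose_sum[OF S assms(4), of m] by simp
  qed
  have count: "real (card {P. partition_list X P \<and> good A B P}) = c (card X)" if "finite X" for X
    using that
  proof (induction "card X" arbitrary: X rule: less_induct)
    case less
    have *: "real (card {P. partition_list (X - K) P \<and> good A B P} * card (item_heads ?S K)) =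
        - (d (card K) * c (card X - card K))" if K: "K \<in> Pow X - {{}}" for K
    proof -
      have "finite K" using K less.prems finite_subset by blast
      moreover from this have "card (X - K) = card X - card K" using K by (simp add: card_Diff_subset)
      moreover have "card (X - K) < card X" using K less.prems by (intro psubset_card_mono) auto
      ultimately show ?thesis using less.hyps[of "X - K"] less.prems heads[of K] K by simp
    qed
    have "real (card {P. partition_list X P \<and> good A B P}) =
        1 - (\<Sum>K \<in> Pow X - {{}}. d (card K) * c (card X - card K))"
      unfolding card_good_partition_lists[OF less.prems S]
      using * by (simp add: sum_negf del: of_nat_mult)
    \<comment> \<open>The empty \<open>K\<close> contributes \<open>c (card X)\<close>. As the full
      sum is 1, the count becomes \<open>1 - (1 - c (card X))\<close>.\<close>
    also have "(\<Sum>K \<in> Pow X - {{}}. d (card K) * c (card X - card K)) =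
        (\<Sum>K \<in> Pow X. d (card K) * c (card X - card K)) - c (card X)"
      using less.prems d0 by (simp add: sum_diff1)
    also have "(\<Sum>K \<in> Pow X. d (card K) * c (card X - card K)) = 1"
      using sum_Pow_card[OF less.prems, of "\<lambda>k. d k * c (card X - k)"] conv by simp
    finally show ?case by simp
  qed
  have "c n = real (card {P. ordered_set_partition n P \<and> good A B P})" for n
    using count[of "{1..n}"] by (simp add: ordered_set_partition_iff)
  then show ?thesis by (metis of_nat_in_Nats)
qed

end
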